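(* Let $(T,d)$ be a metric space with $D(T)<\infty$ and $m$ a Borel probability measure on $T$ with $\operatorname{supp}(m)=T$. Let $a,b\ge0$, $\varphi\in\mathcal{G}_{a,b}$, $R\ge2$, and let $k_0\in\mathbb{Z}$ be the integer with $R^{k_0}\le\varphi^{-1}(1)<R^{k_0+1}$. Set $r_{k_0}(x):=D(T)$ for $x\in T$, and for integers $k>k_0$ and $x\in T$ set $$r_k(x):=\min\left\{\varepsilon\ge0:\varphi^{-1}\left(\frac{1}{m(B(x,\varepsilon))}\right)\le R^k\right\}.$$ For $k\ge k_0$ let $B_k(x):=B(x,r_k(x))$ and let $S_k$ be the linear operator on the space of bounded Borel functions on $T$ given by $$S_kf(x):=\frac{1}{m(B_k(x))}\int_{B_k(x)}f(u)\,m(du).$$ Then for all integers $n>k\ge k_0$, pointwise on $T$, $$S_nS_{n-1}\cdots S_{k+1}r_k\le\sum_{i=k}^{n}2^{i-k}r_i.$$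
   Context: $B(x,\varepsilon)=\{y\in T:d(x,y)\le\varepsilon\}$ is the closed ball and $D(T)=\sup\{d(s,t):s,t\in T\}$ the diameter of $T$. For $a,b\ge0$, $\mathcal{G}_{a,b}$ is the class of all functions $\varphi:\mathbb{R}_+\to\mathbb{R}$ that are (strictly) increasing and continuous, satisfy $\varphi(0)=0$, and satisfy $x\le a+b\frac{\varphi(xy)}{\varphi(y)}$ for all $x\ge 0$, $y\ge\varphi^{-1}(1)$; it is understood that the inverse $\varphi^{-1}$ is defined on $[0,\infty)$. In the definition of $r_k$, values of $\varepsilon$ with $m(B(x,\varepsilon))=0$ (possible only for $\varepsilon=0$) are regarded as giving $\varphi^{-1}(1/0)=+\infty$. *)

theory Defs
  imports "HOL-Probability.Probability"
begin

definition measure_support :: "'a::topological_space measure \<Rightarrow> 'a set" where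
  "measure_support m = {x. \<forall>U. open U \<longrightarrow> x \<in> U \<longrightarrow> emeasure m U > 0}"

text \<open>Functions on the half-line are total functions \<^typ>\<open>real \<Rightarrow> real\<close>; only their values
  on \<^term>\<open>{0::real..}\<close> are constrained or used.\<close>

definition half_line_inv :: "(real \<Rightarrow> real) \<Rightarrow> real \<Rightarrow> real" where
  "half_line_inv \<phi> = inv_into {0..} \<phi>"

text \<open>The image condition says that the inverse is defined on all of \<^term>\<open>{0::real..}\<close>.\<close>

definition growth_class :: "real \<Rightarrow> real \<Rightarrow> (real \<Rightarrow> real) set" where
  "growth_class a b = {\<phi>.
     strict_mono_on {0..} \<phi> \<and> continuous_on {0..} \<phi> \<and> \<phi> 0 = 0 \<and> \<phi> ` {0..} = {0..} \<and>
     (\<forall>x y. x \<ge> 0 \<longrightarrow> y \<ge> half_line_inv \<phi> 1 \<longrightarrow> x \<le> a + b * (\<phi> (x * y) / \<phi> y))}"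

text \<open>The positivity conjunct implements the convention \<open>\<phi>\<inverse>(1/0) = \<infinity>\<close> (HOL has \<open>1/0 = 0\<close>, which
  would wrongly admit balls of measure zero). \<open>LEAST\<close> is the minimum of the set, not just its
  infimum. The function is meaningful for \<open>k \<ge> k0\<close> only.\<close>

definition level_radius ::
    "'a::metric_space measure \<Rightarrow> (real \<Rightarrow> real) \<Rightarrow> real \<Rightarrow> int \<Rightarrow> int \<Rightarrow> 'a \<Rightarrow> real" where
  "level_radius m \<phi> R k0 k x =
     (if k = k0 then diameter (UNIV :: 'a set)
      else (LEAST \<epsilon>. \<epsilon> \<ge> 0 \<and> measure m (cball x \<epsilon>) > 0 \<and>
                     half_line_inv \<phi> (1 / measure m (cball x \<epsilon>)) \<le> R powi k))"

definition level_ball ::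
    "'a::metric_space measure \<Rightarrow> (real \<Rightarrow> real) \<Rightarrow> real \<Rightarrow> int \<Rightarrow> int \<Rightarrow> 'a \<Rightarrow> 'a set" where
  "level_ball m \<phi> R k0 k x = cball x (level_radius m \<phi> R k0 k x)"

text \<open>The averaging operator is intended for bounded Borel functions; it is total because the
  Bochner integral is.\<close>

definition level_average ::
    "'a::metric_space measure \<Rightarrow> (real \<Rightarrow> real) \<Rightarrow> real \<Rightarrow> int \<Rightarrow> int \<Rightarrow> ('a \<Rightarrow> real) \<Rightarrow> 'a \<Rightarrow> real" where
  "level_average m \<phi> R k0 k f x =
     (1 / measure m (level_ball m \<phi> R k0 k x)) *
       (LINT u:level_ball m \<phi> R k0 k x|m. f u)"

text \<open>The composite \<open>S\<^sub>n (S\<^sub>n\<^sub>-\<^sub>1 (\<dots> (S\<^sub>k\<^sub>+\<^sub>1 f)))\<close>: \<^const>\<open>fold\<close> applies the operator with the head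
  of the list first, hence \<open>S\<^sub>k\<^sub>+\<^sub>1\<close> innermost and \<open>S\<^sub>n\<close> outermost.\<close>

definition iterated_average ::
    "'a::metric_space measure \<Rightarrow> (real \<Rightarrow> real) \<Rightarrow> real \<Rightarrow> int \<Rightarrow> int \<Rightarrow> int \<Rightarrow> ('a \<Rightarrow> real) \<Rightarrow> 'a \<Rightarrow> real" where
  "iterated_average m \<phi> R k0 k n f = fold (level_average m \<phi> R k0) [k+1..n] f"

end

theory Submission
  imports Defs
begin

text \<open>Every radius satisfies \<open>r\<^sub>k(u) \<le> r\<^sub>k(x) + d(x,u)\<close>, because \<open>B(x, r\<^sub>k(x))\<close> lies in
  \<open>B(u, r\<^sub>k(x) + d(x,u))\<close>. Hence \<open>r\<^sub>i \<le> r\<^sub>i(x) + r\<^sub>n(x)\<close> on \<open>B\<^sub>n(x)\<close>, so applying \<open>S\<^sub>n\<close> to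
  \<open>\<Sum>\<^sub>i\<^sub><\<^sub>n 2\<^bsup>i-k\<^esup> r\<^sub>i\<close> adds at most \<open>(2\<^bsup>n-k\<^esup> - 1) r\<^sub>n\<close>, and the claim follows by induction on \<open>n\<close>.\<close>

lemma half_line_inv_le_iff:
  assumes mono: "strict_mono_on {0..} \<phi>" and surj: "\<phi> ` {0..} = {0..}"
    and "0 \<le> t" "0 \<le> y"
  shows "half_line_inv \<phi> t \<le> y \<longleftrightarrow> t \<le> \<phi> y"
proof -
  have t: "t \<in> \<phi> ` {0..}" using surj \<open>0 \<le> t\<close> by simp
  have inv: "half_line_inv \<phi> t \<in> {0..}" "\<phi> (half_line_inv \<phi> t) = t"
    unfolding half_line_inv_def using inv_into_into[OF t] f_inv_into_f[OF t] by auto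
  show ?thesis
    using strict_mono_on_less_eq[OF mono inv(1), of y] inv(2) \<open>0 \<le> y\<close> by simp
qed

lemma measure_cball_least_radius:
  fixes m :: "'a::metric_space measure"
  assumes "finite_measure m" and sets: "sets m = sets borel"
    and S: "S = {\<epsilon>. 0 \<le> \<epsilon> \<and> c \<le> measure m (cball x \<epsilon>)}" and "S \<noteq> {}"
  shows "Inf S \<in> S" and "\<And>\<epsilon>. \<epsilon> \<in> S \<Longrightarrow> Inf S \<le> \<epsilon>"
proof -
  interpret finite_measure m by fact
  have bdd: "bdd_below S" unfolding S by (auto intro: bdd_belowI)
  show "\<And>\<epsilon>. \<epsilon> \<in> S \<Longrightarrow> Inf S \<le> \<epsilon>" using bdd by (rule cInf_lower[rotated])
  define A where "A n = cball x (Inf S + inverse (real (Suc n)))" for n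
  have meas: "A n \<in> sets m" for n unfolding A_def sets by simp
  have "decseq A"
    unfolding A_def by (intro decseq_SucI subset_cball add_left_mono) simp
  moreover have "(\<Inter>n. A n) = cball x (Inf S)"
  proof (intro equalityI subsetI)
    fix y assume y: "y \<in> (\<Inter>n. A n)"
    have "(\<lambda>n. Inf S + inverse (real (Suc n))) \<longlonglongrightarrow> Inf S"
      by (rule LIMSEQ_inverse_real_of_nat_add)
    moreover have "dist x y \<le> Inf S + inverse (real (Suc n))" for n
      using y by (simp add: A_def)
    ultimately have "dist x y \<le> Inf S"
      using LIMSEQ_le_const by blast
    then show "y \<in> cball x (Inf S)" by simp
  next
    fix y assume "y \<in> cball x (Inf S)"
    then show "y \<in> (\<Inter>n. A n)" by (simp add: A_def add_increasing2)
  qed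
  ultimately have lim: "(\<lambda>n. measure m (A n)) \<longlonglongrightarrow> measure m (cball x (Inf S))"
    using finite_Lim_measure_decseq[of A] meas by auto
  have "c \<le> measure m (A n)" for n
  proof -
    obtain \<epsilon> where "\<epsilon> \<in> S" "\<epsilon> < Inf S + inverse (real (Suc n))"
      using cInf_lessD[OF \<open>S \<noteq> {}\<close>, of "Inf S + inverse (real (Suc n))"] by auto
    then have "c \<le> measure m (cball x \<epsilon>)" "cball x \<epsilon> \<subseteq> A n"
      by (auto simp: S A_def)
    then show ?thesis using finite_measure_mono[OF _ meas] by (meson order_trans)
  qed
  then have "c \<le> measure m (cball x (Inf S))"
    using LIMSEQ_le_const[OF lim] by blast
  moreover have "0 \<le> Inf S"
    using \<open>S \<noteq> {}\<close> by (intro cInf_greatest) (auto simp: S)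
  ultimately show "Inf S \<in> S" by (simp add: S)
qed

lemma measure_cball_least_radius_dist:
  fixes m :: "'a::metric_space measure"
  assumes fin: "finite_measure m" and sets: "sets m = sets borel"
    and ne: "\<exists>\<epsilon>\<ge>0. c \<le> measure m (cball x \<epsilon>)"
  shows "Inf {\<epsilon>. 0 \<le> \<epsilon> \<and> c \<le> measure m (cball u \<epsilon>)}
           \<le> Inf {\<epsilon>. 0 \<le> \<epsilon> \<and> c \<le> measure m (cball x \<epsilon>)} + dist x u"
proof -
  interpret finite_measure m by fact
  let ?S = "\<lambda>x. {\<epsilon>. 0 \<le> \<epsilon> \<and> c \<le> measure m (cball x \<epsilon>)}"
  have x: "Inf (?S x) \<in> ?S x"
    using ne by (intro measure_cball_least_radius(1)[OF fin sets refl]) auto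
  have "cball x (Inf (?S x)) \<subseteq> cball u (Inf (?S x) + dist x u)"
  proof
    fix y assume "y \<in> cball x (Inf (?S x))"
    then show "y \<in> cball u (Inf (?S x) + dist x u)"
      using dist_triangle[of u y x] by (simp add: dist_commute)
  qed
  then have "measure m (cball x (Inf (?S x))) \<le> measure m (cball u (Inf (?S x) + dist x u))"
    by (intro finite_measure_mono) (simp_all add: sets)
  then have "Inf (?S x) + dist x u \<in> ?S u" using x by auto
  then show ?thesis
    by (intro measure_cball_least_radius(2)[OF fin sets refl]) auto
qed

lemma level_radius_dist:
  fixes m :: "'a::metric_space measure"
  assumes bdd: "bounded (UNIV :: 'a set)" and prob: "prob_space m" and sets: "sets m = sets borel"
    and \<phi>: "\<phi> \<in> growth_class a b" and R: "1 \<le> R"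
    and k0: "half_line_inv \<phi> 1 \<le> R powi (k0 + 1)" and k: "k0 \<le> k"
  shows "0 \<le> level_radius m \<phi> R k0 k x"
    and "level_radius m \<phi> R k0 k u \<le> level_radius m \<phi> R k0 k x + dist x u"
proof -
  interpret prob_space m by fact
  have D: "0 \<le> diameter (UNIV :: 'a set)" using bdd by (rule diameter_ge_0)
  have "0 \<le> level_radius m \<phi> R k0 k x \<and>
        level_radius m \<phi> R k0 k u \<le> level_radius m \<phi> R k0 k x + dist x u"
  proof (cases "k = k0")
    case True
    then show ?thesis using D by (simp add: level_radius_def)
  next
    case False
    have mono: "strict_mono_on {0..} \<phi>" and surj: "\<phi> ` {0..} = {0..}"
      using \<phi> by (auto simp: growth_class_def)
    have Rk: "0 \<le> R powi k" using R by simp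
    have "half_line_inv \<phi> 1 \<le> R powi k"
      using k0 power_int_increasing[OF _ R, of "k0 + 1" k] k False by simp
    then have \<phi>1: "1 \<le> \<phi> (R powi k)"
      using half_line_inv_le_iff[OF mono surj, of 1] Rk by simp
    define c where "c = 1 / \<phi> (R powi k)"
    have c: "0 < c" "c \<le> 1" using \<phi>1 by (auto simp: c_def)
    define S where "S x = {\<epsilon>. 0 \<le> \<epsilon> \<and> c \<le> measure m (cball x \<epsilon>)}" for x
    have iff: "0 \<le> \<epsilon> \<and> measure m (cball y \<epsilon>) > 0 \<and>
        half_line_inv \<phi> (1 / measure m (cball y \<epsilon>)) \<le> R powi k \<longleftrightarrow> \<epsilon> \<in> S y" for y \<epsilon>
    proof (cases "measure m (cball y \<epsilon>) > 0")
      case True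
      then have "half_line_inv \<phi> (1 / measure m (cball y \<epsilon>)) \<le> R powi k
                   \<longleftrightarrow> c \<le> measure m (cball y \<epsilon>)"
        using half_line_inv_le_iff[OF mono surj _ Rk] \<phi>1
        by (simp add: c_def field_simps)
      then show ?thesis using True by (simp add: S_def)
    next
      case False
      then show ?thesis using c by (auto simp: S_def)
    qed
    have D_mem: "diameter (UNIV :: 'a set) \<in> S y" for y
    proof -
      have "cball y (diameter (UNIV :: 'a set)) = UNIV"
        using diameter_bounded_bound[OF bdd] by auto
      moreover have "space m = UNIV" using sets_eq_imp_space_eq[OF sets] by simp
      ultimately have "measure m (cball y (diameter (UNIV :: 'a set))) = 1" using prob_space by simp
      then show ?thesis using c D by (simp add: S_def)
    qed
    have r: "level_radius m \<phi> R k0 k y = Inf (S y)" and mem: "Inf (S y) \<in> S y" for y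
    proof -
      note * = measure_cball_least_radius[OF finite_measure_axioms sets S_def[of y]]
      show "Inf (S y) \<in> S y" using * D_mem by blast
      moreover have "Inf (S y) \<le> \<epsilon>" if "\<epsilon> \<in> S y" for \<epsilon>
        using * that by blast
      ultimately have "(LEAST \<epsilon>. \<epsilon> \<in> S y) = Inf (S y)" by (rule Least_equality)
      then show "level_radius m \<phi> R k0 k y = Inf (S y)"
        using False by (simp add: level_radius_def iff)
    qed
    have "Inf (S u) \<le> Inf (S x) + dist x u"
      unfolding S_def using D_mem[of x]
      by (intro measure_cball_least_radius_dist[OF finite_measure_axioms sets]) (auto simp: S_def)
    then show ?thesis using r mem[of x] by (simp add: S_def)
  qed
  then show "0 \<le> level_radius m \<phi> R k0 k x"
    and "level_radius m \<phi> R k0 k u \<le> level_radius m \<phi> R k0 k x + dist x u" by auto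
qed

text \<open>The condition \<open>0 \<le> C\<close> covers the junk values: the Bochner integral of a non-integrable
  function is 0, and so is the factor \<open>1 / 0\<close> for a null ball.\<close>

lemma level_average_le:
  fixes m :: "'a::metric_space measure"
  assumes "finite_measure m" and sets: "sets m = sets borel"
    and le: "\<And>u. u \<in> level_ball m \<phi> R k0 k x \<Longrightarrow> f u \<le> C" and C: "0 \<le> C"
  shows "level_average m \<phi> R k0 k f x \<le> C"
proof -
  interpret finite_measure m by fact
  let ?B = "level_ball m \<phi> R k0 k x"
  have B: "?B \<in> sets m" by (simp add: level_ball_def sets)
  have "(LINT u:?B|m. f u) \<le> (LINT u|m. indicator ?B u * C)"
    unfolding set_lebesgue_integral_def
  proof (rule integral_mono')
    show "integrable m (\<lambda>u. indicator ?B u * C)"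
      using B by (simp add: emeasure_eq_measure)
  qed (use le C in \<open>auto simp: indicator_def\<close>)
  also have "\<dots> = measure m ?B * C" using B by simp
  finally have "level_average m \<phi> R k0 k f x \<le> 1 / measure m ?B * (measure m ?B * C)"
    unfolding level_average_def by (intro mult_left_mono) auto
  also have "\<dots> \<le> C" using C by simp
  finally show ?thesis .
qed

lemma iterated_average_refl: "iterated_average m \<phi> R k0 k k f = f"
  by (simp add: iterated_average_def)

lemma iterated_average_step:
  assumes "k \<le> n"
  shows "iterated_average m \<phi> R k0 k (n + 1) f
           = level_average m \<phi> R k0 (n + 1) (iterated_average m \<phi> R k0 k n f)"
  using assms upto_rec2[of "k + 1" "n + 1"] by (simp add: iterated_average_def)

lemma sum_atLeastAtMost_int_step:
  fixes f :: "int \<Rightarrow> 'b::comm_monoid_add"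
  assumes "k \<le> n"
  shows "(\<Sum>i=k..n + 1. f i) = (\<Sum>i=k..n. f i) + f (n + 1)"
proof -
  have "{k..n + 1} = insert (n + 1) {k..n}" using assms by auto
  then show ?thesis by (simp add: add.commute)
qed

lemma sum_powi_2:
  fixes k n :: int
  assumes "k \<le> n"
  shows "(\<Sum>i=k..n. 2 powi (i - k)) = (2 powi (n + 1 - k) - 1 :: real)"
  using assms
proof (induction n rule: int_ge_induct)
  case (step n)
  have "(2::real) powi (n + 1 + 1 - k) = 2 powi (n + 1 - k) * 2"
    using power_int_add_1[of "2::real" "n + 1 - k"] by (simp add: algebra_simps)
  then show ?case
    unfolding sum_atLeastAtMost_int_step[OF step.hyps] step.IH by simp
qed simp

theorem lemma2p2:
  fixes m :: "'a::metric_space measure"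
    and \<phi> :: "real \<Rightarrow> real"
    and a b R :: real
    and k0 :: int
  assumes "bounded (UNIV :: 'a set)"
    and "prob_space m"
    and "sets m = sets borel"
    and "measure_support m = UNIV"
    and "a \<ge> 0" and "b \<ge> 0"
    and "\<phi> \<in> growth_class a b"
    and "R \<ge> 2"
    and "R powi k0 \<le> half_line_inv \<phi> 1"
    and "half_line_inv \<phi> 1 < R powi (k0 + 1)"
  shows "\<forall>n k :: int. n > k \<longrightarrow> k \<ge> k0 \<longrightarrow>
           (\<forall>x. iterated_average m \<phi> R k0 k n (level_radius m \<phi> R k0 k) x
              \<le> (\<Sum>i=k..n. 2 powi (i - k) * level_radius m \<phi> R k0 i x))"
proof (intro allI impI)
  fix n k :: int and x :: 'a
  assume kn: "k < n" and k: "k0 \<le> k"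
  interpret prob_space m by fact
  define r where "r = level_radius m \<phi> R k0"
  have r: "0 \<le> r i x" "r i u \<le> r i x + dist x u" if "k \<le> i" for i x u
    unfolding r_def
    by (rule level_radius_dist[where a = a and b = b]; use assms k that in simp)+
  have "\<forall>x. iterated_average m \<phi> R k0 k n (r k) x \<le> (\<Sum>i=k..n. 2 powi (i - k) * r i x)"
    using less_imp_le[OF kn]
  proof (induction n rule: int_ge_induct)
    case base
    then show ?case by (simp add: iterated_average_refl)
  next
    case (step n)
    show ?case
    proof
      fix x
      let ?s = "\<Sum>i=k..n. 2 powi (i - k) * r i x" and ?r = "r (n + 1) x"
      have pow: "(\<Sum>i=k..n. 2 powi (i - k)) = (2 powi (n + 1 - k) - 1 :: real)"
        using step.hyps by (rule sum_powi_2)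
      have "iterated_average m \<phi> R k0 k (n + 1) (r k) x
              \<le> (\<Sum>i=k..n. 2 powi (i - k) * (r i x + ?r))"
        unfolding iterated_average_step[OF step.hyps]
      proof (rule level_average_le[OF finite_measure_axioms assms(3)])
        fix u assume "u \<in> level_ball m \<phi> R k0 (n + 1) x"
        then have "dist x u \<le> ?r" by (simp add: level_ball_def r_def)
        then have "r i u \<le> r i x + ?r" if "k \<le> i" for i
          using r(2)[OF that, of u x] by simp
        then have "(\<Sum>i=k..n. 2 powi (i - k) * r i u) \<le> (\<Sum>i=k..n. 2 powi (i - k) * (r i x + ?r))"
          by (intro sum_mono mult_left_mono) auto
        then show "iterated_average m \<phi> R k0 k n (r k) u
                     \<le> (\<Sum>i=k..n. 2 powi (i - k) * (r i x + ?r))"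
          using step.IH by (meson order_trans)
      qed (use r(1) step.hyps in \<open>auto intro!: sum_nonneg\<close>)
      also have "\<dots> = ?s + (2 powi (n + 1 - k) - 1) * ?r"
        by (simp add: distrib_left sum.distrib pow flip: sum_distrib_right)
      also have "\<dots> \<le> ?s + 2 powi (n + 1 - k) * ?r"
        using r(1)[of "n + 1" x] step.hyps by (simp add: left_diff_distrib)
      also have "\<dots> = (\<Sum>i=k..n + 1. 2 powi (i - k) * r i x)"
        using step.hyps by (simp add: sum_atLeastAtMost_int_step)
      finally show "iterated_average m \<phi> R k0 k (n + 1) (r k) x \<le> \<dots>" .
    qed
  qed
  then show "iterated_average m \<phi> R k0 k n (level_radius m \<phi> R k0 k) x
      \<le> (\<Sum>i=k..n. 2 powi (i - k) * level_radius m \<phi> R k0 i x)"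
    unfolding r_def by blast
qed

end
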